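(* Let $F_1,F_2$ be two task time distributions such that $F_1$ is smaller than $F_2$ in stochastic order, i.e. $\overline F_1(t)\le\overline F_2(t)$ for all $t$. Then for any fixed failure time distribution $G$, the total time distribution $H_{F_1,G}$ is smaller than $H_{F_2,G}$ in stochastic order, i.e. $\overline H_{F_1,G}(x)\le\overline H_{F_2,G}(x)$ for all $x$.
   Context: RESTART model: for given distributions $F$ and $G$ on $[0,\infty)$, $T$ is a random variable (task time) with distribution $F$, and $U, U_1,U_2,\ldots$ are i.i.d. random variables (failure times) with distribution $G$, independent of $T$. $N=\inf\{n\ge 0:\,U_{n+1}>T\}$, $S=\sum_{i=1}^N U_i$, and the total time is $X=T+S$ (with $X=\infty$ if $N=\infty$). $H_{F,G}$ denotes the distribution of $X$. A bar denotes the tail: $\overline F(t)=1-F(t)$, $\overline H_{F,G}(x)=\mathbb P(X>x)$. Standing assumptions: all task time distributions and $G$ have densities, the task time distributions have unbounded support, and $\mathbb E U<\infty$. *)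

theory Defs
  imports "HOL-Probability.Probability"
begin

text \<open>Distributions on the (extended) real line are represented by their Borel laws. The tail is
  taken of a measure on an arbitrary linear order, so that it applies both to task time laws on
  \<^typ>\<open>real\<close> and to total time laws, which may charge \<open>\<infinity>\<close>, on \<^typ>\<open>ereal\<close>.\<close>

definition tail :: "'a::linorder measure \<Rightarrow> 'a \<Rightarrow> real" where
  "tail F t = measure F {t<..}"

definition stochastic_le :: "'a::linorder measure \<Rightarrow> 'a measure \<Rightarrow> bool" where
  "stochastic_le F1 F2 \<longleftrightarrow> (\<forall>t. tail F1 t \<le> tail F2 t)"

lemma (in real_distribution) tail_eq_one_minus_cdf: "tail M t = 1 - cdf M t"
proof -
  have "UNIV - {..t} = {t<..}"
    by auto
  then show ?thesis
    using prob_compl[of "{..t}"] by (simp add: tail_def cdf_def)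
qed

definition measure_support :: "'a::topological_space measure \<Rightarrow> 'a set" where
  "measure_support F = {x. \<forall>V. open V \<and> x \<in> V \<longrightarrow> emeasure F V > 0}"

definition time_distribution :: "real measure \<Rightarrow> bool" where
  "time_distribution F \<longleftrightarrow>
     real_distribution F \<and> (AE t in F. 0 \<le> t) \<and>
     (\<exists>f \<in> borel_measurable lborel. F = density lborel f)"

definition task_time_distribution :: "real measure \<Rightarrow> bool" where
  "task_time_distribution F \<longleftrightarrow> time_distribution F \<and> \<not> bounded (measure_support F)"

definition failure_time_distribution :: "real measure \<Rightarrow> bool" where
  "failure_time_distribution G \<longleftrightarrow> time_distribution G \<and> integrable G (\<lambda>u. u)"

text \<open>\<open>U 0\<close> is the generic failure time, \<open>U 1, U 2, \<dots>\<close> are the successive failure times.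
  Mutual independence of the whole family \<open>T, U 0, U 1, U 2, \<dots>\<close> says that the failure times are
  independent of each other and that the failure time sequence is independent of \<open>T\<close>.\<close>

locale restart_model = prob_space M
  for M :: "'a measure" and T :: "'a \<Rightarrow> real" and U :: "nat \<Rightarrow> 'a \<Rightarrow> real"
    and F G :: "real measure" +
  assumes T_measurable: "random_variable borel T"
    and T_law: "distr M borel T = F"
    and U_measurable: "\<And>i. random_variable borel (U i)"
    and U_law: "\<And>i. distr M borel (U i) = G"
    and indep: "indep_vars (\<lambda>_. borel) (case_option T U) UNIV"

text \<open>In \<^typ>\<open>enat\<close> the infimum of the empty set is \<open>\<infinity>\<close>.\<close>

definition restart_count :: "('a \<Rightarrow> real) \<Rightarrow> (nat \<Rightarrow> 'a \<Rightarrow> real) \<Rightarrow> 'a \<Rightarrow> enat" where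
  "restart_count T U \<omega> = Inf {enat n | n. U (n + 1) \<omega> > T \<omega>}"

definition total_time :: "('a \<Rightarrow> real) \<Rightarrow> (nat \<Rightarrow> 'a \<Rightarrow> real) \<Rightarrow> 'a \<Rightarrow> ereal" where
  "total_time T U \<omega> =
     (case restart_count T U \<omega> of
        enat n \<Rightarrow> ereal (T \<omega> + (\<Sum>i=1..n. U i \<omega>))
      | \<infinity> \<Rightarrow> \<infinity>)"

definition total_time_law ::
    "'a measure \<Rightarrow> ('a \<Rightarrow> real) \<Rightarrow> (nat \<Rightarrow> 'a \<Rightarrow> real) \<Rightarrow> ereal measure" where
  "total_time_law M T U = distr M borel (total_time T U)"

lemma restart_count_measurable:
  assumes [measurable]: "T \<in> borel_measurable M" "\<And>i. U i \<in> borel_measurable M"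
  shows "restart_count T U \<in> M \<rightarrow>\<^sub>M count_space UNIV"
proof -
  have "restart_count T U = (\<lambda>\<omega>. INF n. if U (n + 1) \<omega> > T \<omega> then enat n else \<infinity>)"
    unfolding restart_count_def
  proof (intro ext antisym)
    fix \<omega>
    show "Inf {enat n | n. U (n + 1) \<omega> > T \<omega>} \<le> (INF n. if U (n + 1) \<omega> > T \<omega> then enat n else \<infinity>)"
      by (rule INF_greatest) (auto intro: Inf_lower)
    show "(INF n. if U (n + 1) \<omega> > T \<omega> then enat n else \<infinity>) \<le> Inf {enat n | n. U (n + 1) \<omega> > T \<omega>}"
      by (rule Inf_greatest) (auto intro!: Inf_lower)
  qed
  also have "\<dots> \<in> M \<rightarrow>\<^sub>M count_space UNIV"
    by measurable
  finally show ?thesis .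
qed

lemma total_time_measurable:
  assumes [measurable]: "T \<in> borel_measurable M" "\<And>i. U i \<in> borel_measurable M"
  shows "total_time T U \<in> borel_measurable M"
proof -
  note restart_count_measurable[OF assms, measurable]
  have "total_time T U = (\<lambda>\<omega>. (\<lambda>k \<omega>. case k of
      enat n \<Rightarrow> ereal (T \<omega> + (\<Sum>i=1..n. U i \<omega>)) | \<infinity> \<Rightarrow> \<infinity>) (restart_count T U \<omega>) \<omega>)"
    by (simp add: total_time_def fun_eq_iff)
  also have "\<dots> \<in> borel_measurable M"
  proof (rule measurable_compose_countable)
    fix k :: enat
    show "(\<lambda>\<omega>. case k of enat n \<Rightarrow> ereal (T \<omega> + (\<Sum>i=1..n. U i \<omega>)) | \<infinity> \<Rightarrow> \<infinity>) \<in> borel_measurable M"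
      by (cases k) auto
  qed simp
  finally show ?thesis .
qed

text \<open>By measurability, the tail of the total time law is \<open>P(X > x)\<close>.\<close>

lemma (in restart_model) tail_total_time_law:
  "tail (total_time_law M T U) x = \<P>(\<omega> in M. total_time T U \<omega> > x)"
proof -
  have [measurable]: "total_time T U \<in> borel_measurable M"
    by (intro total_time_measurable T_measurable U_measurable)
  show ?thesis
    by (auto simp: tail_def total_time_law_def measure_distr intro!: arg_cong[where f = "measure M"])
qed

end

theory Submission
  imports Defs
begin

text \<open>The total time is a function of the task time and of the sequence of failure times. For a
  fixed sequence of nonnegative failure times it is monotone in the task time: a longer task
  survives no earlier, so it incurs at least as many failures, and both the task time and the sum
  of failure times grow (\<open>total_time_mono\<close>). Hence the set of task times for which the total time
  exceeds a level is upward closed, and a stochastically larger law gives such a set at least as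
  much mass (\<open>stochastic_le_upward_closed\<close>). By independence, the tail of the total time is the
  average of these masses over the failure time sequences, whose law, the infinite power of \<open>G\<close>,
  does not depend on the task time law (\<open>tail_total_time_law_eq_integral\<close>). The comparison thus
  survives the averaging.\<close>

text \<open>An upward closed set of reals is empty, everything, an open ray or a closed ray. The order
  compares open rays by definition; a closed ray is a decreasing limit of open ones.\<close>

lemma stochastic_le_upward_closed:
  fixes F1 F2 :: "real measure"
  assumes "real_distribution F1" "real_distribution F2"
    and le: "stochastic_le F1 F2"
    and up: "\<And>s t. s \<in> A \<Longrightarrow> s \<le> t \<Longrightarrow> t \<in> A"
  shows "measure F1 A \<le> measure F2 A"
proof -
  interpret F1: real_distribution F1 by fact
  interpret F2: real_distribution F2 by fact
  have ray: "measure F1 {t<..} \<le> measure F2 {t<..}" for t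
    using le by (simp add: stochastic_le_def tail_def)
  consider "A = {}" | "A \<noteq> {}" "\<not> bdd_below A" | "A \<noteq> {}" "bdd_below A"
    by (cases "A = {}"; cases "bdd_below A") simp_all
  then show ?thesis
  proof cases
    case 1
    then show ?thesis by simp
  next
    case 2
    have "t \<in> A" for t
    proof -
      obtain s where "s \<in> A" "\<not> t \<le> s"
        using 2 unfolding bdd_below_def by blast
      then show ?thesis
        using up[of s t] by simp
    qed
    then have "A = UNIV"
      by blast
    then show ?thesis
      using F1.prob_space F2.prob_space by simp
  next
    case 3
    have above: "t \<in> A" if "Inf A < t" for t
      using cInf_lessD[OF 3(1) that] up less_imp_le by blast
    have below: "Inf A \<le> t" if "t \<in> A" for t
      using that 3 by (simp add: cInf_lower)
    show ?thesis
    proof (cases "Inf A \<in> A")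
      case False
      have "A = {Inf A<..}"
      proof (intro set_eqI iffI)
        fix t assume "t \<in> A"
        moreover from this have "t \<noteq> Inf A"
          using False by blast
        ultimately show "t \<in> {Inf A<..}"
          using below[of t] by simp
      qed (simp add: above)
      then show ?thesis
        using ray[of "Inf A"] by simp
    next
      case True
      define R where "R n = {Inf A - inverse (real (Suc n))<..}" for n
      have "A = (\<Inter>n. R n)"
      proof (intro set_eqI iffI)
        fix t assume "t \<in> A"
        have "t \<in> R n" for n
        proof -
          have "0 < inverse (real (Suc n))"
            by simp
          then show ?thesis
            unfolding R_def greaterThan_iff using below[OF \<open>t \<in> A\<close>] by linarith
        qed
        then show "t \<in> (\<Inter>n. R n)"
          by blast
      next
        fix t assume t: "t \<in> (\<Inter>n. R n)"
        have "Inf A \<le> t"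
        proof (rule ccontr)
          assume "\<not> Inf A \<le> t"
          then obtain n where "inverse (real (Suc n)) < Inf A - t"
            using reals_Archimedean[of "Inf A - t"] by auto
          moreover have "t \<in> R n"
            using t by blast
          ultimately show False
            unfolding R_def greaterThan_iff by linarith
        qed
        then show "t \<in> A"
          using True up by blast
      qed
      moreover have "decseq R"
        unfolding decseq_def
      proof (intro allI impI subsetI)
        fix m n :: nat and t assume "m \<le> n" "t \<in> R n"
        moreover from \<open>m \<le> n\<close> have "inverse (real (Suc n)) \<le> inverse (real (Suc m))"
          by (intro le_imp_inverse_le) auto
        ultimately show "t \<in> R m"
          unfolding R_def greaterThan_iff by linarith
      qed
      ultimately have
        "(\<lambda>n. measure F1 (R n)) \<longlonglongrightarrow> measure F1 A" "(\<lambda>n. measure F2 (R n)) \<longlonglongrightarrow> measure F2 A"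
        using F1.finite_Lim_measure_decseq[of R] F2.finite_Lim_measure_decseq[of R]
        unfolding \<open>A = (\<Inter>n. R n)\<close> by (simp_all add: R_def image_subset_iff)
      then show ?thesis
        by (rule LIMSEQ_le) (auto simp: R_def ray)
    qed
  qed
qed

text \<open>For a longer task, fewer failure times terminate the sequence of restarts, so the restart
  count is an infimum over a smaller set; further failures only add nonnegative terms.\<close>

lemma total_time_mono:
  assumes T: "T \<omega> \<le> T' \<omega>'" and U: "\<And>i. U i \<omega> = U' i \<omega>'" and nonneg: "\<And>i. 0 \<le> U i \<omega>"
  shows "total_time T U \<omega> \<le> total_time T' U' \<omega>'"
proof (cases "restart_count T' U' \<omega>'")
  case infinity
  then show ?thesis
    by (simp add: total_time_def)
next
  case (enat n')
  have "restart_count T U \<omega> \<le> restart_count T' U' \<omega>'"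
    unfolding restart_count_def using T by (intro Inf_superset_mono) (auto simp: U)
  then obtain n where n: "restart_count T U \<omega> = enat n" "n \<le> n'"
    using enat by (cases "restart_count T U \<omega>") auto
  have "(\<Sum>i=1..n. U i \<omega>) \<le> (\<Sum>i=1..n'. U i \<omega>)"
    using n nonneg by (intro sum_mono2) auto
  then show ?thesis
    using T n enat by (simp add: total_time_def U)
qed

context restart_model
begin

text \<open>This is the marginal, on the indices of the failure times, of the product law of the whole
  family.\<close>

lemma failure_sequence_law:
  "distr M (PiM UNIV (\<lambda>_. borel)) (\<lambda>\<omega> i. U i \<omega>) = PiM UNIV (\<lambda>_. G)"
proof -
  let ?V = "case_option T U"
  let ?L = "\<lambda>i. distr M borel (?V i)"
  have V: "random_variable borel (?V i)" for i
    by (cases i) (simp_all add: T_measurable U_measurable)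
  have sets: "sets (PiM UNIV (\<lambda>_::nat. G)) = sets (PiM UNIV (\<lambda>_. borel))"
    by (intro sets_PiM_cong) (auto simp: U_law[of 0, symmetric])
  have "PiM UNIV (\<lambda>_. G) = distr (PiM UNIV ?L) (PiM UNIV (\<lambda>_. G)) (\<lambda>f n. f (Some n))"
    using distr_PiM_reindex[of UNIV ?L Some UNIV] prob_space_distr[OF V]
    by (simp add: U_law restrict_UNIV)
  also have "\<dots> = distr (distr M (PiM UNIV (\<lambda>_. borel)) (\<lambda>\<omega> i. ?V i \<omega>)) (PiM UNIV (\<lambda>_. borel))
      (\<lambda>f n. f (Some n))"
    using indep_vars_iff_distr_eq_PiM[of UNIV ?V "\<lambda>_. borel", OF _ V] indep sets
    by (intro distr_cong) (simp_all add: restrict_UNIV)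
  also have "\<dots> = distr M (PiM UNIV (\<lambda>_. borel)) (\<lambda>\<omega> i. U i \<omega>)"
    by (subst distr_distr) (auto intro!: measurable_PiM_single' simp: V o_def)
  finally show ?thesis ..
qed

text \<open>The index set of the independent family splits into the task time and the failure times. The
  two groups are first taken as families indexed by \<^typ>\<open>nat option\<close> and only then reindexed, because
  \<open>indep_var\<close> relates only random variables with values in the same type.\<close>

lemma joint_law:
  "distr M (borel \<Otimes>\<^sub>M PiM UNIV (\<lambda>_. borel)) (\<lambda>\<omega>. (T \<omega>, \<lambda>i. U i \<omega>)) = F \<Otimes>\<^sub>M PiM UNIV (\<lambda>_. G)"
proof -
  let ?S = "PiM UNIV (\<lambda>_. borel) :: (nat \<Rightarrow> real) measure"
  let ?P = "PiM {None} (\<lambda>_. borel) :: (nat option \<Rightarrow> real) measure"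
  let ?Q = "PiM (range Some) (\<lambda>_. borel) :: (nat option \<Rightarrow> real) measure"
  define X where "X \<omega> = restrict (\<lambda>i. case_option T U i \<omega>) {None}" for \<omega>
  define Y where "Y \<omega> = restrict (\<lambda>i. case_option T U i \<omega>) (range Some)" for \<omega>
  define p :: "(nat option \<Rightarrow> real) \<Rightarrow> real" where "p f = f None" for f
  define q :: "(nat option \<Rightarrow> real) \<Rightarrow> nat \<Rightarrow> real" where "q f i = f (Some i)" for f i
  have "indep_var ?P X ?Q Y"
    unfolding X_def Y_def by (rule indep_var_restrict[OF indep]) auto
  then have [measurable]: "X \<in> M \<rightarrow>\<^sub>M ?P" "Y \<in> M \<rightarrow>\<^sub>M ?Q"
    and XY: "distr M ?P X \<Otimes>\<^sub>M distr M ?Q Y = distr M (?P \<Otimes>\<^sub>M ?Q) (\<lambda>\<omega>. (X \<omega>, Y \<omega>))"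
    by (simp_all add: indep_var_distribution_eq)
  have [measurable]: "p \<in> ?P \<rightarrow>\<^sub>M borel"
    unfolding p_def by measurable
  have [measurable]: "q \<in> ?Q \<rightarrow>\<^sub>M ?S"
    unfolding q_def by (intro measurable_PiM_single') auto
  have pX: "p (X \<omega>) = T \<omega>" and qY: "q (Y \<omega>) = (\<lambda>i. U i \<omega>)" for \<omega>
    by (simp_all add: p_def q_def X_def Y_def fun_eq_iff)
  have F: "distr (distr M ?P X) borel p = F"
    by (simp add: distr_distr o_def pX T_law)
  have S: "distr (distr M ?Q Y) ?S q = PiM UNIV (\<lambda>_. G)"
    by (simp add: distr_distr o_def qY failure_sequence_law)
  have "(\<lambda>\<omega> i. U i \<omega>) \<in> M \<rightarrow>\<^sub>M ?S"
    by (intro measurable_PiM_single') (auto simp: U_measurable)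
  then interpret S: prob_space "distr (distr M ?Q Y) ?S q"
    unfolding S failure_sequence_law[symmetric] by (rule prob_space_distr)
  have "F \<Otimes>\<^sub>M PiM UNIV (\<lambda>_. G) = distr (distr M ?P X) borel p \<Otimes>\<^sub>M distr (distr M ?Q Y) ?S q"
    by (simp only: F S)
  also have "\<dots> = distr (distr M ?P X \<Otimes>\<^sub>M distr M ?Q Y) (borel \<Otimes>\<^sub>M ?S) (\<lambda>(f, g). (p f, q g))"
    by (rule pair_measure_distr) (simp_all add: S.sigma_finite_measure_axioms)
  also have "\<dots> = distr M (borel \<Otimes>\<^sub>M ?S) (\<lambda>\<omega>. (T \<omega>, \<lambda>i. U i \<omega>))"
    unfolding XY by (subst distr_distr) (simp_all add: o_def pX qY)
  finally show ?thesis ..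
qed

text \<open>By the theorem of Fubini and Tonelli on the product space of task times and failure time
  sequences, where the coordinate maps take the roles of \<open>T\<close> and \<open>U\<close>. The right-hand side depends
  on the model only through \<open>F\<close> and \<open>G\<close>, so models on different sample spaces become comparable.\<close>

lemma tail_total_time_law_eq_integral:
  "ennreal (tail (total_time_law M T U) x) =
    (\<integral>\<^sup>+u. emeasure F {t. x < total_time fst (\<lambda>i p. snd p i) (t, u)} \<partial>PiM UNIV (\<lambda>_. G))"
proof -
  let ?S = "PiM UNIV (\<lambda>_. borel) :: (nat \<Rightarrow> real) measure"
  let ?\<Phi> = "total_time fst (\<lambda>i p. snd p i) :: real \<times> (nat \<Rightarrow> real) \<Rightarrow> ereal"
  note [measurable] = T_measurable U_measurable
  have setsF: "sets F = sets borel" and setsG: "sets G = sets borel"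
    using T_law U_law by (metis sets_distr)+
  then have sets: "sets (F \<Otimes>\<^sub>M PiM UNIV (\<lambda>_. G)) = sets (borel \<Otimes>\<^sub>M ?S)"
    by (intro sets_pair_measure_cong sets_PiM_cong) auto
  interpret F: prob_space F
    using prob_space_distr[OF T_measurable] by (simp add: T_law)
  interpret G: prob_space G
    using prob_space_distr[OF U_measurable] by (simp add: U_law)
  interpret S: product_prob_space "\<lambda>_. G" "UNIV :: nat set" ..
  interpret FS: pair_sigma_finite F "PiM UNIV (\<lambda>_. G) :: (nat \<Rightarrow> real) measure" ..
  have [measurable]: "?\<Phi> \<in> borel_measurable (borel \<Otimes>\<^sub>M ?S)"
    by (intro total_time_measurable) measurable
  have [measurable]: "(\<lambda>\<omega>. (T \<omega>, \<lambda>i. U i \<omega>)) \<in> M \<rightarrow>\<^sub>M borel \<Otimes>\<^sub>M ?S"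
    by (intro measurable_Pair T_measurable measurable_PiM_single') auto
  have \<Phi>: "?\<Phi> (T \<omega>, \<lambda>i. U i \<omega>) = total_time T U \<omega>" for \<omega>
    by (simp add: total_time_def restart_count_def split: enat.split)
  have space: "space (borel \<Otimes>\<^sub>M ?S) = UNIV"
    by (simp add: space_pair_measure space_PiM)
  have Q: "{p. x < ?\<Phi> p} \<in> sets (borel \<Otimes>\<^sub>M ?S)"
    using measurable_sets[of ?\<Phi> "borel \<Otimes>\<^sub>M ?S" borel "{x<..}"]
    by (simp add: space vimage_def)
  have "ennreal (tail (total_time_law M T U) x) = emeasure M {\<omega> \<in> space M. x < total_time T U \<omega>}"
    by (simp add: tail_total_time_law emeasure_eq_measure)
  also have "\<dots> = emeasure (distr M (borel \<Otimes>\<^sub>M ?S) (\<lambda>\<omega>. (T \<omega>, \<lambda>i. U i \<omega>))) {p. x < ?\<Phi> p}"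
    using Q by (subst emeasure_distr) (auto simp: \<Phi> intro!: arg_cong[where f = "emeasure M"])
  also have "\<dots> = emeasure (F \<Otimes>\<^sub>M PiM UNIV (\<lambda>_. G)) {p. x < ?\<Phi> p}"
    by (simp add: joint_law)
  also have "\<dots> = (\<integral>\<^sup>+u. emeasure F {t. x < ?\<Phi> (t, u)} \<partial>PiM UNIV (\<lambda>_. G))"
    using Q by (subst FS.emeasure_pair_measure_alt2) (auto simp: sets vimage_def)
  finally show ?thesis .
qed

end

lemma AE_PiM_nonneg:
  fixes G :: "real measure"
  assumes "prob_space G" "AE u in G. 0 \<le> u"
  shows "AE u in PiM UNIV (\<lambda>_::nat. G). \<forall>i. 0 \<le> u i"
  unfolding AE_all_countable
  by (intro allI AE_PiM_component[where P = "\<lambda>u. 0 \<le> u"] UNIV_I assms)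

theorem proposition2p2:
  fixes F1 F2 G :: "real measure"
    and M1 :: "'a measure" and T1 :: "'a \<Rightarrow> real" and U1 :: "nat \<Rightarrow> 'a \<Rightarrow> real"
    and M2 :: "'b measure" and T2 :: "'b \<Rightarrow> real" and U2 :: "nat \<Rightarrow> 'b \<Rightarrow> real"
  assumes "task_time_distribution F1" and "task_time_distribution F2"
    and "failure_time_distribution G"
    and "restart_model M1 T1 U1 F1 G" and "restart_model M2 T2 U2 F2 G"
    and "stochastic_le F1 F2"
  shows "stochastic_le (total_time_law M1 T1 U1) (total_time_law M2 T2 U2)"
  unfolding stochastic_le_def
proof
  fix x :: ereal
  interpret R1: restart_model M1 T1 U1 F1 G by fact
  interpret R2: restart_model M2 T2 U2 F2 G by fact
  have F: "real_distribution F1" "real_distribution F2"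
    using assms(1,2) by (auto simp: task_time_distribution_def time_distribution_def)
  interpret F1: real_distribution F1 by fact
  interpret F2: real_distribution F2 by fact
  have "prob_space G" "AE u in G. 0 \<le> u"
    using assms(3)
    by (auto simp: failure_time_distribution_def time_distribution_def real_distribution_def)
  note nonneg = AE_PiM_nonneg[OF this]
  let ?A = "\<lambda>u. {t. x < total_time fst (\<lambda>i p. snd p i) (t :: real, u :: nat \<Rightarrow> real)}"
  have slice: "emeasure F1 (?A u) \<le> emeasure F2 (?A u)" if "\<forall>i. 0 \<le> u i" for u
  proof -
    have "t \<in> ?A u" if "s \<in> ?A u" "s \<le> t" for s t
      using that \<open>\<forall>i. 0 \<le> u i\<close>
        total_time_mono[of fst "(s, u)" fst "(t, u)" "\<lambda>i p. snd p i" "\<lambda>i p. snd p i"]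
      by (auto intro: less_le_trans)
    then have "measure F1 (?A u) \<le> measure F2 (?A u)"
      by (rule stochastic_le_upward_closed[OF F assms(6)])
    then show ?thesis
      by (simp add: F1.emeasure_eq_measure F2.emeasure_eq_measure)
  qed
  have "ennreal (tail (total_time_law M1 T1 U1) x) \<le> ennreal (tail (total_time_law M2 T2 U2) x)"
    unfolding R1.tail_total_time_law_eq_integral R2.tail_total_time_law_eq_integral
    using nonneg slice by (auto intro!: nn_integral_mono_AE)
  then show "tail (total_time_law M1 T1 U1) x \<le> tail (total_time_law M2 T2 U2) x"
    by (simp add: tail_def)
qed

end
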